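(* Let $R$ be a finite non-trivial unital ring, $V$ a finite left $R$-module, $n$ a positive integer, $G$ a subgroup of the symmetric group of degree $n$ such that $|G|$ is a unit in $R$, and $\theta = \frac{1}{|G|}\sum_{g\in G} g \in R[G]$. Let $M$ be a set of nondegenerate $\mathbb{Q}/\mathbb{Z}$-valued $\mathbb{Z}$-bilinear forms on $V$, and let $C \subset V^n$ be a $G$-code. Then the $G$-Hamming weight enumerator satisfies \[ \mathrm{hwe}_G(\theta C)(x,y) = \frac{1}{|\theta(C^{\perp_M})|}\, \mathrm{hwe}_G(\theta(C^{\perp_M}))\bigl(x+(|V|-1)y,\; x-y\bigr). \]
   Context: A $\mathbb{Q}/\mathbb{Z}$-valued $\mathbb{Z}$-bilinear form on $V$ is a homomorphism of abelian groups $\beta\colon V\otimes_{\mathbb{Z}} V\to\mathbb{Q}/\mathbb{Z}$; $\mathrm{Bil}(V,\mathbb{Q}/\mathbb{Z})$ is the set of these. It is nondegenerate if $\beta(v\otimes w)=0$ for all $w\in V$ implies $v=0$ (for finite $V$ this is equivalent to the analogous condition in the other argument). Put $\beta^n(u\otimes v)=\sum_{i=1}^n\beta(u_i\otimes v_i)$ for $u,v\in V^n$. $G$ acts on $V^n$ by $g\cdot v=(v_{g^{-1}(1)},\dots,v_{g^{-1}(n)})$, making $V^n$ a left $R[G]$-module. A $G$-code is an $R[G]$-submodule $C$ of $V^n$ (i.e. a $G$-stable $R$-submodule). For a subset $X\subset V^n$, $\theta X=\theta(X)=\{\theta u\mid u\in X\}$. For $M\subset\mathrm{Bil}(V,\mathbb{Q}/\mathbb{Z})$,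 \[ C^{\perp_M}=\{v\in V^n\mid \beta^n(v\otimes u)=0\text{ for all }\beta\in M,\ u\in C\}. \] Let $\alpha_1,\dots,\alpha_t\in\{1,\dots,n\}$ be a complete system of representatives of the $G$-orbits on $\{1,\dots,n\}$ ($t$ is the number of orbits). The elements of $\theta(V^n)$ are exactly the vectors $u=(u_1,\dots,u_n)\in V^n$ that are constant on each orbit, and $u\mapsto u_G=(u_{\alpha_1},\dots,u_{\alpha_t})$ is an $R$-module isomorphism $\theta(V^n)\to V^t$. The $G$-Hamming weight of $u\in\theta(V^n)$ is $\mathrm{wt}_G(u)=|\{i\in\{1,\dots,t\}\mid u_{\alpha_i}\neq0\}|$. For a subset $D\subset\theta(V^n)$ (such as $\theta C$ or $\theta(C^{\perp_M})$), \[ \mathrm{hwe}_G(D)(x,y)=\sum_{u\in D}x^{t-\mathrm{wt}_G(u)}y^{\mathrm{wt}_G(u)}\in\mathbb{C}[x,y]. \]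
   Formalization: Added hypothesis: some β in M satisfies θ(C^{⊥_M}) = θ(C^{⊥_{β}}) (so M is nonempty). Without it the identity fails: n=1, G=1, R=F_2, V=F_2^2, M={dot product, hyperbolic form}, C=<e_1> gives x+y on the left and x+3y on the right. *)

theory Defs
  imports
    "HOL-Algebra.Sym_Groups"
    "HOL-Algebra.Group_Action"
    "HOL-Computational_Algebra.Polynomial"
begin

definition rat_cong :: "rat \<Rightarrow> rat \<Rightarrow> bool" where
  "rat_cong a b \<longleftrightarrow> a - b \<in> \<int>"

lemma equivp_rat_cong: "equivp rat_cong"
proof (rule equivpI)
  show "reflp rat_cong"
    by (simp add: reflp_def rat_cong_def)
  show "symp rat_cong"
    unfolding symp_def rat_cong_def by (metis Ints_minus minus_diff_eq)
  show "transp rat_cong"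
  proof (rule transpI)
    fix a b c assume "rat_cong a b" "rat_cong b c"
    then have "(a - b) + (b - c) \<in> \<int>"
      unfolding rat_cong_def by (rule Ints_add)
    then show "rat_cong a c" by (simp add: rat_cong_def)
  qed
qed

quotient_type qmodz = rat / rat_cong
  by (rule equivp_rat_cong)

instantiation qmodz :: ab_group_add
begin

lift_definition zero_qmodz :: qmodz is 0 .

lift_definition plus_qmodz :: "qmodz \<Rightarrow> qmodz \<Rightarrow> qmodz" is "(+)"
  unfolding rat_cong_def by (metis Ints_add add_diff_add)

lift_definition uminus_qmodz :: "qmodz \<Rightarrow> qmodz" is uminus
  unfolding rat_cong_def by (metis Ints_minus minus_diff_eq minus_diff_minus)

lift_definition minus_qmodz :: "qmodz \<Rightarrow> qmodz \<Rightarrow> qmodz" is "(-)"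
  unfolding rat_cong_def by (metis Ints_diff diff_diff_eq2 diff_add_eq add_diff_eq diff_diff_add add.commute)

instance
  by standard (transfer; simp add: rat_cong_def)+

end

text \<open>The library locale \<open>module\<close> requires commutative scalars.\<close>

locale left_module =
  fixes scale :: "'r::ring_1 \<Rightarrow> 'v::ab_group_add \<Rightarrow> 'v"
  assumes scale_right_distrib: "scale a (x + y) = scale a x + scale a y"
    and scale_left_distrib: "scale (a + b) x = scale a x + scale b x"
    and scale_scale: "scale a (scale b x) = scale (a * b) x"
    and scale_one: "scale 1 x = x"

definition unit_elem :: "'r::ring_1 \<Rightarrow> bool" where
  "unit_elem a \<longleftrightarrow> (\<exists>b. a * b = 1 \<and> b * a = 1)"

definition unit_inv :: "'r::ring_1 \<Rightarrow> 'r" where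
  "unit_inv a = (THE b. a * b = 1 \<and> b * a = 1)"

text \<open>A homomorphism on the tensor square over the integers is given by the biadditive map
  that it induces on pairs.\<close>

definition Bil :: "('v::ab_group_add \<Rightarrow> 'v \<Rightarrow> qmodz) set" where
  "Bil = {\<beta>. (\<forall>u v w. \<beta> (u + v) w = \<beta> u w + \<beta> v w) \<and>
             (\<forall>u v w. \<beta> u (v + w) = \<beta> u v + \<beta> u w)}"

definition nondegenerate :: "('v::ab_group_add \<Rightarrow> 'v \<Rightarrow> qmodz) \<Rightarrow> bool" where
  "nondegenerate \<beta> \<longleftrightarrow> (\<forall>v. (\<forall>w. \<beta> v w = 0) \<longrightarrow> v = 0)"

definition form_power :: "nat \<Rightarrow> ('v \<Rightarrow> 'v \<Rightarrow> qmodz) \<Rightarrow> (nat \<Rightarrow> 'v) \<Rightarrow> (nat \<Rightarrow> 'v) \<Rightarrow> qmodz" where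
  "form_power n \<beta> u v = (\<Sum>i = 1..n. \<beta> (u i) (v i))"

text \<open>Vectors of length \<open>n\<close> are functions on \<open>{1..n}\<close>, extended by \<open>undefined\<close>.\<close>

definition vecs :: "nat \<Rightarrow> (nat \<Rightarrow> 'v) set" where
  "vecs n = {1..n} \<rightarrow>\<^sub>E UNIV"

definition perm_act :: "nat \<Rightarrow> (nat \<Rightarrow> nat) \<Rightarrow> (nat \<Rightarrow> 'v) \<Rightarrow> (nat \<Rightarrow> 'v)" where
  "perm_act n g v = (\<lambda>i\<in>{1..n}. v (inv' g i))"

text \<open>An element of the group ring \<open>R[G]\<close> is represented by its family of coefficients.\<close>

definition group_ring :: "(nat \<Rightarrow> nat) set \<Rightarrow> ((nat \<Rightarrow> nat) \<Rightarrow> 'r) set" where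
  "group_ring G = G \<rightarrow>\<^sub>E UNIV"

definition group_ring_act ::
  "('r \<Rightarrow> 'v::ab_group_add \<Rightarrow> 'v) \<Rightarrow> nat \<Rightarrow> (nat \<Rightarrow> nat) set
    \<Rightarrow> ((nat \<Rightarrow> nat) \<Rightarrow> 'r) \<Rightarrow> (nat \<Rightarrow> 'v) \<Rightarrow> (nat \<Rightarrow> 'v)" where
  "group_ring_act scale n G a v = (\<lambda>i\<in>{1..n}. \<Sum>g\<in>G. scale (a g) (perm_act n g v i))"

definition theta :: "(nat \<Rightarrow> nat) set \<Rightarrow> (nat \<Rightarrow> nat) \<Rightarrow> 'r::ring_1" where
  "theta G = (\<lambda>g\<in>G. unit_inv (of_nat (card G)))"

definition theta_act ::
  "('r::ring_1 \<Rightarrow> 'v::ab_group_add \<Rightarrow> 'v) \<Rightarrow> nat \<Rightarrow> (nat \<Rightarrow> nat) set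
    \<Rightarrow> (nat \<Rightarrow> 'v) \<Rightarrow> (nat \<Rightarrow> 'v)" where
  "theta_act scale n G = group_ring_act scale n G (theta G)"

text \<open>Closure under \<open>R[G]\<close> contains closure under scalars (elements supported at the identity).\<close>

definition G_code ::
  "('r \<Rightarrow> 'v::ab_group_add \<Rightarrow> 'v) \<Rightarrow> nat \<Rightarrow> (nat \<Rightarrow> nat) set \<Rightarrow> (nat \<Rightarrow> 'v) set \<Rightarrow> bool" where
  "G_code scale n G C \<longleftrightarrow>
     C \<subseteq> vecs n \<and>
     (\<lambda>i\<in>{1..n}. 0) \<in> C \<and>
     (\<forall>u\<in>C. \<forall>v\<in>C. (\<lambda>i\<in>{1..n}. u i + v i) \<in> C) \<and>
     (\<forall>a\<in>group_ring G. \<forall>v\<in>C. group_ring_act scale n G a v \<in> C)"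

text \<open>The code is in the second argument of the forms, which need not be symmetric.\<close>

definition dual_code ::
  "nat \<Rightarrow> ('v \<Rightarrow> 'v \<Rightarrow> qmodz) set \<Rightarrow> (nat \<Rightarrow> 'v) set \<Rightarrow> (nat \<Rightarrow> 'v) set" where
  "dual_code n M C = {v \<in> vecs n. \<forall>\<beta>\<in>M. \<forall>u\<in>C. form_power n \<beta> v u = 0}"

definition perm_group :: "nat \<Rightarrow> (nat \<Rightarrow> nat) set \<Rightarrow> (nat \<Rightarrow> nat) monoid" where
  "perm_group n G = (sym_group n)\<lparr>carrier := G\<rparr>"

definition orbit_reps :: "nat \<Rightarrow> (nat \<Rightarrow> nat) set \<Rightarrow> nat \<Rightarrow> (nat \<Rightarrow> nat) \<Rightarrow> bool" where
  "orbit_reps n G t \<alpha> \<longleftrightarrow>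
     \<alpha> \<in> {1..t} \<rightarrow> {1..n} \<and>
     bij_betw (\<lambda>i. orbit (perm_group n G) (\<lambda>g. g) (\<alpha> i)) {1..t}
       (orbits (perm_group n G) {1..n} (\<lambda>g. g))"

definition wt_G :: "nat \<Rightarrow> (nat \<Rightarrow> nat) \<Rightarrow> (nat \<Rightarrow> 'v::zero) \<Rightarrow> nat" where
  "wt_G t \<alpha> u = card {i \<in> {1..t}. u (\<alpha> i) \<noteq> 0}"

text \<open>Bivariate complex polynomials are represented in the iterated polynomial ring; the
  enumerator takes as arguments the polynomials to be substituted for the two variables.\<close>

definition hwe_G ::
  "nat \<Rightarrow> (nat \<Rightarrow> nat) \<Rightarrow> (nat \<Rightarrow> 'v::zero) set
    \<Rightarrow> complex poly poly \<Rightarrow> complex poly poly \<Rightarrow> complex poly poly" where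
  "hwe_G t \<alpha> D x y = (\<Sum>u\<in>D. x ^ (t - wt_G t \<alpha> u) * y ^ wt_G t \<alpha> u)"

definition X_var :: "complex poly poly" where
  "X_var = [:[:0, 1:]:]"

definition Y_var :: "complex poly poly" where
  "Y_var = [:0, 1:]"

end

theory Submission
  imports Defs
begin

text \<open>Since \<open>|G|\<close> is invertible, \<open>\<theta>C\<close> is the set of \<open>G\<close>-fixed vectors of \<open>C\<close>, and
  \<open>\<theta>(C\<^sup>\<bottom>)\<close> is the annihilator of \<open>\<theta>C\<close> among the fixed vectors. Reading off one value per orbit
  turns fixed vectors into elements of \<open>V\<^sup>t\<close>, where the form becomes a sum of coordinate forms, the
  \<open>k\<close>-th being \<open>\<beta>\<close> multiplied by the length of the \<open>k\<close>-th orbit. Orbit lengths divide \<open>|G|\<close>, hence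
  act invertibly on \<open>V\<close> and the coordinate forms stay nondegenerate. The claim is then the
  MacWilliams identity for additive codes in \<open>V\<^sup>t\<close>, proved by summing the characters
  \<open>exp (2 \<pi> i \<beta>(v, w))\<close>.\<close>

section \<open>Character sums and the MacWilliams identity over a finite set of coordinates\<close>

lemma sum_eq_0_if_translated:
  fixes f :: "'b \<Rightarrow> 'a::idom"
  assumes "bij_betw \<tau> H H" and "\<And>h. h \<in> H \<Longrightarrow> f (\<tau> h) = c * f h" and "c \<noteq> 1"
  shows "sum f H = 0"
proof -
  have "sum f H = (\<Sum>h\<in>H. f (\<tau> h))"
    using sum.reindex_bij_betw[OF assms(1), of f] by simp
  also have "\<dots> = c * sum f H"
    using assms(2) by (simp add: sum_distrib_left)
  finally show ?thesis
    using assms(3) by simp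
qed

text \<open>The form \<open>b i\<close> may depend on the coordinate, since each orbit will
  contribute its own multiple of \<beta>.\<close>

definition annihilator ::
  "'i set \<Rightarrow> ('i \<Rightarrow> 'v \<Rightarrow> 'w \<Rightarrow> 'q::comm_monoid_add) \<Rightarrow> ('i \<Rightarrow> 'w) set \<Rightarrow> ('i \<Rightarrow> 'v) set" where
  "annihilator I b D = {w \<in> I \<rightarrow>\<^sub>E UNIV. \<forall>u\<in>D. (\<Sum>i\<in>I. b i (w i) (u i)) = 0}"

text \<open>Written as a product over coordinates so that sums over all words factor
  coordinatewise.\<close>

definition weight_enum ::
  "'i set \<Rightarrow> ('i \<Rightarrow> 'v::zero) set \<Rightarrow> 'a \<Rightarrow> 'a \<Rightarrow> 'a::comm_semiring_1" where
  "weight_enum I A x y = (\<Sum>u\<in>A. \<Prod>i\<in>I. if u i = 0 then x else y)"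

text \<open>The target is any integral domain of characteristic zero, so that the identity can be
  instantiated directly in the bivariate polynomial ring. The trivial kernel lets the character
  detect every nonzero form value.\<close>

locale faithful_char =
  fixes \<chi> :: "'q::ab_group_add \<Rightarrow> 'a::{idom, ring_char_0}"
  assumes char_add: "\<chi> (a + b) = \<chi> a * \<chi> b"
    and char_eq_1_iff: "\<chi> a = 1 \<longleftrightarrow> a = 0"
begin

lemma char_0 [simp]: "\<chi> 0 = 1"
  by (simp add: char_eq_1_iff)

lemma char_sum: "finite A \<Longrightarrow> \<chi> (sum f A) = (\<Prod>i\<in>A. \<chi> (f i))"
  by (induction A rule: finite_induct) (simp_all add: char_add)

text \<open>Orthogonality: if \<open>f a \<noteq> 0\<close>, translation by \<open>a\<close>
  permutes the group and multiplies the sum by \<open>\<chi> (f a) \<noteq> 1\<close>, which in a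
  domain forces it to vanish.\<close>

lemma sum_char_additive:
  fixes f :: "'v::{finite, ab_group_add} \<Rightarrow> 'q"
  assumes "\<And>u v. f (u + v) = f u + f v"
  shows "(\<Sum>v\<in>UNIV. \<chi> (f v)) = (if \<forall>v. f v = 0 then of_nat (card (UNIV :: 'v set)) else 0)"
proof (cases "\<forall>v. f v = 0")
  case False
  then obtain a where a: "f a \<noteq> 0" by blast
  have "(\<Sum>v\<in>UNIV. \<chi> (f v)) = 0"
  proof (rule sum_eq_0_if_translated)
    show "bij_betw ((+) a) UNIV UNIV" by simp
    show "\<chi> (f (a + h)) = \<chi> (f a) * \<chi> (f h)" for h
      by (simp add: assms char_add)
    show "\<chi> (f a) \<noteq> 1" using a by (simp add: char_eq_1_iff)
  qed
  with False show ?thesis by simp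
qed simp

text \<open>Summing \<open>\<chi> (b v w)\<close> over all pairs in both orders counts the right radical.\<close>

lemma right_nondegenerate_if_left:
  fixes b :: "'v::{finite, ab_group_add} \<Rightarrow> 'w::{finite, ab_group_add} \<Rightarrow> 'q"
  assumes add_left: "\<And>u v w. b (u + v) w = b u w + b v w"
    and add_right: "\<And>u v w. b u (v + w) = b u v + b u w"
    and left: "\<And>v. (\<And>w. b v w = 0) \<Longrightarrow> v = 0"
    and card: "card (UNIV :: 'v set) = card (UNIV :: 'w set)"
    and w: "\<And>v. b v w = 0"
  shows "w = 0"
proof -
  define R where "R = {w. \<forall>v. b v w = 0}"
  have b0: "b 0 w = 0" for w using add_left[of 0 0 w] by simp
  have b0': "b v 0 = 0" for v using add_right[of v 0 0] by simp
  have "(\<Sum>v\<in>UNIV. \<Sum>w\<in>UNIV. \<chi> (b v w))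
    = (\<Sum>v\<in>(UNIV :: 'v set). if v = 0 then of_nat (card (UNIV :: 'w set)) else 0)"
  proof (rule sum.cong)
    fix v
    have "(\<forall>w. b v w = 0) \<longleftrightarrow> v = 0" using left[of v] b0 by auto
    then show "(\<Sum>w\<in>UNIV. \<chi> (b v w)) = (if v = 0 then of_nat (card (UNIV :: 'w set)) else 0)"
      by (simp add: sum_char_additive add_right)
  qed simp
  then have 1: "(\<Sum>v\<in>UNIV. \<Sum>w\<in>UNIV. \<chi> (b v w)) = of_nat (card (UNIV :: 'w set))"
    by simp
  have "(\<Sum>w\<in>UNIV. \<Sum>v\<in>UNIV. \<chi> (b v w))
    = (\<Sum>w\<in>UNIV. if w \<in> R then of_nat (card (UNIV :: 'v set)) else 0)"
    by (intro sum.cong) (auto simp: sum_char_additive add_left R_def)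
  also have "\<dots> = of_nat (card R * card (UNIV :: 'v set))"
    by (simp add: sum.If_cases)
  finally have "(\<Sum>v\<in>UNIV. \<Sum>w\<in>UNIV. \<chi> (b v w)) = of_nat (card R * card (UNIV :: 'v set))"
    by (subst sum.swap)
  with 1 have "card R * card (UNIV :: 'v set) = card (UNIV :: 'v set)"
    using card by (metis of_nat_eq_iff)
  then have "card R = 1" by simp
  then obtain r where "R = {r}" by (auto simp: card_1_singleton_iff)
  moreover have "0 \<in> R" "w \<in> R" using b0' w by (auto simp: R_def)
  ultimately show ?thesis by auto
qed

text \<open>Fourier transform of the one-coordinate weight function: that function is the constant
  \<open>y\<close> plus a spike \<open>x - y\<close> at 0, and orthogonality evaluates the constant
  part.\<close>

lemma sum_char_weight:
  fixes f :: "'v::{finite, ab_group_add} \<Rightarrow> 'q"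
  assumes "\<And>u v. f (u + v) = f u + f v"
  shows "(\<Sum>v\<in>UNIV. (if v = 0 then x else y) * \<chi> (f v))
    = (if \<forall>v. f v = 0 then x + (of_nat (card (UNIV :: 'v set)) - 1) * y else x - y)"
proof -
  have f0: "f 0 = 0" using assms[of 0 0] by simp
  have "(\<Sum>v\<in>UNIV. (if v = 0 then x else y) * \<chi> (f v))
    = (\<Sum>v\<in>UNIV. (if v = 0 then x - y else 0) + y * \<chi> (f v))"
    by (intro sum.cong) (auto simp: f0)
  also have "\<dots> = (x - y) + y * (\<Sum>v\<in>UNIV. \<chi> (f v))"
    by (simp add: sum.distrib sum_distrib_left)
  also have "\<dots> = (if \<forall>v. f v = 0 then x + (of_nat (card (UNIV :: 'v set)) - 1) * y else x - y)"
    unfolding sum_char_additive[OF assms] by (simp add: algebra_simps)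
  finally show ?thesis .
qed

context
  fixes I :: "'i set" and b :: "'i \<Rightarrow> 'v::{finite, ab_group_add} \<Rightarrow> 'v \<Rightarrow> 'q"
    and D :: "('i \<Rightarrow> 'v) set"
  assumes I: "finite I"
    and add_left: "\<And>i u v w. b i (u + v) w = b i u w + b i v w"
    and add_right: "\<And>i u v w. b i u (v + w) = b i u v + b i u w"
    and nondeg: "\<And>i w. i \<in> I \<Longrightarrow> (\<And>v. b i v w = 0) \<Longrightarrow> w = 0"
    and D: "D \<subseteq> I \<rightarrow>\<^sub>E UNIV"
    and D_0: "(\<lambda>i\<in>I. 0) \<in> D"
    and D_add: "\<And>u v. u \<in> D \<Longrightarrow> v \<in> D \<Longrightarrow> (\<lambda>i\<in>I. u i + v i) \<in> D"
begin

lemma finite_PiE_UNIV: "finite (I \<rightarrow>\<^sub>E (UNIV :: 'v set))"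
  by (intro finite_PiE I) simp

lemma finite_D: "finite D"
  using D finite_PiE_UNIV by (rule finite_subset)

lemma sum_char_D:
  "(\<Sum>u\<in>D. \<chi> (\<Sum>i\<in>I. b i (w i) (u i)))
    = (if \<forall>u\<in>D. (\<Sum>i\<in>I. b i (w i) (u i)) = 0 then of_nat (card D) else 0)"
proof (cases "\<forall>u\<in>D. (\<Sum>i\<in>I. b i (w i) (u i)) = 0")
  case False
  then obtain a where a: "a \<in> D" "(\<Sum>i\<in>I. b i (w i) (a i)) \<noteq> 0" by blast
  have "(\<Sum>u\<in>D. \<chi> (\<Sum>i\<in>I. b i (w i) (u i))) = 0"
  proof (rule sum_eq_0_if_translated)
    have "inj_on (\<lambda>u. \<lambda>i\<in>I. a i + u i) D"
    proof (rule inj_onI)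
      fix u v assume uv: "u \<in> D" "v \<in> D" and eq: "(\<lambda>i\<in>I. a i + u i) = (\<lambda>i\<in>I. a i + v i)"
      show "u = v"
      proof (rule PiE_ext)
        show "u \<in> I \<rightarrow>\<^sub>E UNIV" "v \<in> I \<rightarrow>\<^sub>E UNIV" using uv D by auto
        show "u i = v i" if "i \<in> I" for i
          using fun_cong[OF eq, of i] that by simp
      qed
    qed
    moreover have "(\<lambda>u. \<lambda>i\<in>I. a i + u i) ` D \<subseteq> D"
      using D_add a by auto
    \<comment> \<open>Finiteness makes the injective translation onto; \<open>D\<close> is only
      known to be closed under addition.\<close>
    ultimately show "bij_betw (\<lambda>u. \<lambda>i\<in>I. a i + u i) D D"
      using finite_D by (simp add: bij_betw_def endo_inj_surj)
    show "\<chi> (\<Sum>i\<in>I. b i (w i) ((\<lambda>i\<in>I. a i + h i) i))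
      = \<chi> (\<Sum>i\<in>I. b i (w i) (a i)) * \<chi> (\<Sum>i\<in>I. b i (w i) (h i))" for h
      by (simp add: add_right sum.distrib char_add)
    show "\<chi> (\<Sum>i\<in>I. b i (w i) (a i)) \<noteq> 1" using a by (simp add: char_eq_1_iff)
  qed
  then show ?thesis unfolding if_not_P[OF False] .
qed simp

text \<open>Poisson summation. Each coordinate factor of a word \<open>u\<close> is a one-coordinate
  Fourier transform; expanding the product gives a sum over all words \<open>w\<close>, and summing
  the characters over \<open>D\<close> first keeps exactly the annihilating
  \<open>w\<close>.\<close>

lemma weight_enum_transform:
  fixes x y :: 'a
  shows "weight_enum I D (x + (of_nat (card (UNIV :: 'v set)) - 1) * y) (x - y)
    = of_nat (card D) * weight_enum I (annihilator I b D) x y"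
proof -
  let ?f = "\<lambda>v::'v. if v = 0 then x else y"
  have right_0: "b i v 0 = 0" for i v using add_right[of i v 0 0] by simp
  have "weight_enum I D (x + (of_nat (card (UNIV :: 'v set)) - 1) * y) (x - y)
    = (\<Sum>u\<in>D. \<Prod>i\<in>I. \<Sum>v\<in>UNIV. ?f v * \<chi> (b i v (u i)))"
    unfolding weight_enum_def
  proof (intro sum.cong prod.cong refl)
    fix u i assume "i \<in> I"
    \<comment> \<open>The transform sums over the first argument, so nondegeneracy in the second one
      decides which of its two values occurs.\<close>
    then have "(\<forall>v. b i v (u i) = 0) \<longleftrightarrow> u i = 0"
      using nondeg[of i "u i"] right_0 by auto
    then show "(if u i = 0 then x + (of_nat (card (UNIV :: 'v set)) - 1) * y else x - y)
      = (\<Sum>v\<in>UNIV. ?f v * \<chi> (b i v (u i)))"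
      by (subst sum_char_weight) (simp_all add: add_left)
  qed
  also have "\<dots> = (\<Sum>u\<in>D. \<Sum>w\<in>I \<rightarrow>\<^sub>E UNIV. \<Prod>i\<in>I. ?f (w i) * \<chi> (b i (w i) (u i)))"
    by (intro sum.cong refl prod_sum_PiE) (simp_all add: I)
  also have "\<dots> = (\<Sum>w\<in>I \<rightarrow>\<^sub>E UNIV. \<Sum>u\<in>D. \<Prod>i\<in>I. ?f (w i) * \<chi> (b i (w i) (u i)))"
    by (rule sum.swap)
  also have "\<dots> = (\<Sum>w\<in>I \<rightarrow>\<^sub>E UNIV. (\<Prod>i\<in>I. ?f (w i)) * (\<Sum>u\<in>D. \<chi> (\<Sum>i\<in>I. b i (w i) (u i))))"
    by (simp add: prod.distrib char_sum[OF I] sum_distrib_left)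
  also have "\<dots> = (\<Sum>w\<in>I \<rightarrow>\<^sub>E UNIV. if w \<in> annihilator I b D then of_nat (card D) * (\<Prod>i\<in>I. ?f (w i)) else 0)"
    by (intro sum.cong refl) (auto simp: sum_char_D annihilator_def)
  also have "\<dots> = (\<Sum>w\<in>annihilator I b D. of_nat (card D) * (\<Prod>i\<in>I. ?f (w i)))"
    using finite_PiE_UNIV
    by (subst sum.inter_restrict[symmetric]) (auto simp: annihilator_def intro!: sum.cong)
  finally show ?thesis
    by (simp add: weight_enum_def sum_distrib_left)
qed

text \<open>Applying the transform twice multiplies both variables by \<open>q = |V|\<close>; the point \<open>(1, 1)\<close>
  of the single transform shows that \<open>q ^ |I|\<close> is the product of the two cardinalities.\<close>

lemma MacWilliams:
  fixes x y :: 'a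
  shows "of_nat (card (annihilator I b D)) * weight_enum I D x y
    = weight_enum I (annihilator I b D) (x + (of_nat (card (UNIV :: 'v set)) - 1) * y) (x - y)"
proof -
  define q :: 'a where "q = of_nat (card (UNIV :: 'v set))"
  have card_D: "of_nat (card D) \<noteq> (0 :: 'a)"
    using D_0 finite_D by auto
  \<comment> \<open>At (1, 1) the transformed variables are \<open>q\<close> and 0, so every nonzero
    word has a vanishing factor and only the zero word counts.\<close>
  have "weight_enum I D q 0 = (\<Sum>u\<in>D. if u = (\<lambda>i\<in>I. 0) then q ^ card I else 0)"
    unfolding weight_enum_def
  proof (intro sum.cong refl)
    fix u assume "u \<in> D"
    with D have u: "u \<in> I \<rightarrow>\<^sub>E UNIV" by auto
    show "(\<Prod>i\<in>I. if u i = 0 then q else 0) = (if u = (\<lambda>i\<in>I. 0) then q ^ card I else 0)"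
    proof (cases "u = (\<lambda>i\<in>I. 0)")
      case False
      have "\<exists>i\<in>I. u i \<noteq> 0"
      proof (rule ccontr)
        assume "\<not> (\<exists>i\<in>I. u i \<noteq> 0)"
        then have "u = (\<lambda>i\<in>I. 0)"
          by (intro PiE_ext[OF u]) auto
        with False show False ..
      qed
      with False I show ?thesis by (auto intro!: prod_zero)
    qed simp
  qed
  also have "\<dots> = q ^ card I"
    using finite_D D_0 by simp
  finally have "q ^ card I = of_nat (card D) * weight_enum I (annihilator I b D) 1 (1 :: 'a)"
    using weight_enum_transform[of 1 1] by (simp add: q_def)
  then have cards: "q ^ card I = of_nat (card D) * of_nat (card (annihilator I b D))"
    by (simp add: weight_enum_def)
  have "of_nat (card D) * weight_enum I (annihilator I b D) (x + (q - 1) * y) (x - y)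
    = weight_enum I D (x + (q - 1) * y + (q - 1) * (x - y)) (x + (q - 1) * y - (x - y))"
    using weight_enum_transform[of "x + (q - 1) * y" "x - y"] by (simp add: q_def)
  also have "x + (q - 1) * y + (q - 1) * (x - y) = q * x"
    by (simp add: algebra_simps)
  also have "x + (q - 1) * y - (x - y) = q * y"
    by (simp add: algebra_simps)
  also have "weight_enum I D (q * x) (q * y) = q ^ card I * weight_enum I D x y"
  proof -
    have "(\<Prod>i\<in>I. if u i = 0 then q * x else q * y)
      = (\<Prod>i\<in>I. q * (if u i = 0 then x else y))" for u :: "'i \<Rightarrow> 'v"
      by (intro prod.cong) auto
    then show ?thesis
      by (simp add: weight_enum_def prod.distrib sum_distrib_left)
  qed
  finally have "of_nat (card D) * weight_enum I (annihilator I b D) (x + (q - 1) * y) (x - y)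
    = of_nat (card D) * (of_nat (card (annihilator I b D)) * weight_enum I D x y)"
    by (simp add: cards)
  with card_D show ?thesis
    by (simp add: q_def)
qed

end

end

section \<open>The faithful character of Q/Z\<close>

lemma cis_2pi_eq_1_iff: "cis (2 * pi * x) = 1 \<longleftrightarrow> x \<in> \<int>"
proof
  assume "cis (2 * pi * x) = 1"
  then have "cos (2 * pi * x) = 1"
    by (simp add: complex_eq_iff)
  then obtain m :: int where "2 * pi * x = real_of_int m * 2 * pi"
    by (subst (asm) cos_one_2pi_int) blast
  then have "x = real_of_int m" by simp
  then show "x \<in> \<int>" by simp
qed simp

lemma of_rat_in_Ints_iff: "(of_rat r :: real) \<in> \<int> \<longleftrightarrow> r \<in> \<int>"
proof
  assume "(of_rat r :: real) \<in> \<int>"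
  then obtain m where "(of_rat r :: real) = of_int m" by (auto elim: Ints_cases)
  then have "(of_rat r :: real) = of_rat (of_int m)" by simp
  then have "r = of_int m" by (simp only: of_rat_eq_iff)
  then show "r \<in> \<int>" by simp
qed (auto elim!: Ints_cases)

text \<open>The standard embedding of Q/Z in the unit circle; representatives differ by an integer,
  where the exponential is 1.\<close>

lift_definition qmodz_char :: "qmodz \<Rightarrow> complex" is "\<lambda>r. cis (2 * pi * of_rat r)"
proof -
  fix r s assume "rat_cong r s"
  then have "cis (2 * pi * of_rat (r - s)) = 1"
    unfolding cis_2pi_eq_1_iff by (simp add: rat_cong_def of_rat_in_Ints_iff)
  then have "cis (2 * pi * of_rat r) / cis (2 * pi * of_rat s) = 1"
    by (simp add: cis_divide of_rat_diff algebra_simps)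
  then show "cis (2 * pi * of_rat r) = cis (2 * pi * of_rat s)"
    by simp
qed

text \<open>Values are viewed as constant polynomials, which places the character in the ring of the
  enumerators.\<close>

interpretation qmodz_char: faithful_char "\<lambda>a. [:[:qmodz_char a:]:]"
proof
  show "[:[:qmodz_char (a + b):]:] = [:[:qmodz_char a:]:] * [:[:qmodz_char b:]:]" for a b
    by simp (transfer, simp add: cis_mult of_rat_add algebra_simps)
  show "[:[:qmodz_char a:]:] = 1 \<longleftrightarrow> a = 0" for a
    by (simp add: one_pCons) (transfer, simp add: cis_2pi_eq_1_iff of_rat_in_Ints_iff rat_cong_def)
qed

section \<open>Left modules, inverses of units and biadditive forms\<close>

lemma (in left_module) scale_zero_right [simp]: "scale a 0 = 0"
  using scale_right_distrib[of a 0 0] by simp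

lemma (in left_module) scale_zero_left [simp]: "scale 0 v = 0"
  using scale_left_distrib[of 0 0 v] by simp

text \<open>Bridge between repeated addition and ring scalars: biadditive forms respect the left
  side, while invertibility of \<open>|G|\<close> concerns the right side.\<close>

lemma (in left_module) sum_const_eq_scale: "(\<Sum>a\<in>A. v) = scale (of_nat (card A)) v"
  by (induction A rule: infinite_finite_induct) (simp_all add: scale_left_distrib scale_one)

lemma (in left_module) scale_sum: "scale a (sum f A) = (\<Sum>i\<in>A. scale a (f i))"
  by (induction A rule: infinite_finite_induct) (simp_all add: scale_right_distrib)

lemma unit_inv:
  assumes "unit_elem (a :: 'r::ring_1)"
  shows "a * unit_inv a = 1" and "unit_inv a * a = 1"
proof -
  \<comment> \<open>Two-sided inverses are unique even without commutativity, so the definite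
    description is well defined.\<close>
  have "\<exists>!b. a * b = 1 \<and> b * a = 1"
    using assms unfolding unit_elem_def by (metis mult.assoc mult.right_neutral mult_1_left)
  from theI'[OF this] show "a * unit_inv a = 1" "unit_inv a * a = 1"
    by (simp_all add: unit_inv_def)
qed

lemma Bil_sum:
  assumes "\<beta> \<in> Bil"
  shows "\<beta> (sum f A) w = (\<Sum>a\<in>A. \<beta> (f a) w)" and "\<beta> v (sum f A) = (\<Sum>a\<in>A. \<beta> v (f a))"
proof -
  interpret left: Modules.additive "\<lambda>v. \<beta> v w"
    using assms by unfold_locales (auto simp: Bil_def)
  interpret right: Modules.additive "\<beta> v"
    using assms by unfold_locales (auto simp: Bil_def)
  show "\<beta> (sum f A) w = (\<Sum>a\<in>A. \<beta> (f a) w)" by (rule left.sum)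
  show "\<beta> v (sum f A) = (\<Sum>a\<in>A. \<beta> v (f a))" by (rule right.sum)
qed

section \<open>Averaging over the group, fixed vectors and the dual code\<close>

locale averaging = left_module scale
  for scale :: "'r::ring_1 \<Rightarrow> 'v::ab_group_add \<Rightarrow> 'v" +
  fixes n :: nat and G :: "(nat \<Rightarrow> nat) set"
  assumes subgroup_G: "subgroup G (sym_group n)"
    and unit_card_G: "unit_elem (of_nat (card G) :: 'r)"
begin

lemma G_permutes: "g \<in> G \<Longrightarrow> g permutes {1..n}"
  using subgroup.subset[OF subgroup_G] by (auto simp: sym_group_carrier)

lemma G_id: "id \<in> G"
  using subgroup.one_closed[OF subgroup_G] by (simp add: sym_group_one)

lemma G_comp: "g \<in> G \<Longrightarrow> h \<in> G \<Longrightarrow> g \<circ> h \<in> G"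
  using subgroup.m_closed[OF subgroup_G] by (simp add: sym_group_mult)

lemma G_inv: "g \<in> G \<Longrightarrow> inv' g \<in> G"
  using subgroup.m_inv_closed[OF subgroup_G] G_permutes
  by (metis sym_group_carrier sym_group_inv_equality)

lemma G_image: "g \<in> G \<Longrightarrow> i \<in> {1..n} \<Longrightarrow> g i \<in> {1..n}"
  by (meson G_permutes permutes_in_image)

lemma G_inv_cancel [simp]:
  assumes "g \<in> G"
  shows "inv' g (g i) = i" "g (inv' g i) = i" "inv' (inv' g) = g"
  using G_permutes[OF assms] by (simp_all add: permutes_inverses permutes_inv_inv)

lemma sum_G_inv: "(\<Sum>g\<in>G. f (inv' g)) = (\<Sum>g\<in>G. f g)"
  by (rule sum.reindex_bij_witness[of _ "inv'" "inv'"]) (auto simp: G_inv)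

lemma sum_G_translate:
  assumes "h \<in> G"
  shows "(\<Sum>g\<in>G. f (g (h i))) = (\<Sum>g\<in>G. f (g i))"
  using assms
  by (intro sum.reindex_bij_witness[of _ "\<lambda>g. g \<circ> inv' h" "\<lambda>g. g \<circ> h"])
     (auto simp: G_inv G_comp fun_eq_iff)

lemma sum_permuted: "g \<in> G \<Longrightarrow> (\<Sum>i=1..n. f (g i)) = (\<Sum>i=1..n. f i)"
  using sum.permute[OF G_permutes, of g f] by (simp add: comp_def)

abbreviation weight :: 'r where
  "weight \<equiv> unit_inv (of_nat (card G))"

lemma sum_scale_weight: "(\<Sum>g\<in>G. scale weight v) = v"
  using unit_inv[OF unit_card_G] by (simp add: sum_const_eq_scale scale_scale scale_one)

lemma scale_weight_sum: "scale weight (\<Sum>g\<in>G. v) = v"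
  using unit_inv[OF unit_card_G] by (simp add: sum_const_eq_scale scale_scale scale_one)

text \<open>All coefficients of \<open>theta G\<close> are equal, so reindexing by inversion removes
  the inverse from the permutation action.\<close>

lemma theta_act_apply:
  assumes "i \<in> {1..n}"
  shows "theta_act scale n G v i = (\<Sum>g\<in>G. scale weight (v (g i)))"
proof -
  have "theta_act scale n G v i = (\<Sum>g\<in>G. scale weight (v (inv' g i)))"
    using assms by (simp add: theta_act_def group_ring_act_def theta_def perm_act_def)
  then show ?thesis
    using sum_G_inv[of "\<lambda>g. scale weight (v (g i))"] by simp
qed

text \<open>The image of the averaging projection; equivalently, the vectors constant on every
  orbit.\<close>

definition fixed_vecs :: "(nat \<Rightarrow> 'v) set" where
  "fixed_vecs = {u \<in> vecs n. \<forall>g\<in>G. \<forall>i\<in>{1..n}. u (g i) = u i}"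

lemma theta_act_fixed: "theta_act scale n G v \<in> fixed_vecs"
proof -
  have "theta_act scale n G v \<in> vecs n"
    by (auto simp: theta_act_def group_ring_act_def vecs_def)
  moreover have "theta_act scale n G v (g i) = theta_act scale n G v i"
    if "g \<in> G" "i \<in> {1..n}" for g i
    unfolding theta_act_apply[OF that(2)] theta_act_apply[OF G_image[OF that]]
    by (rule sum_G_translate[OF that(1)])
  ultimately show ?thesis by (simp add: fixed_vecs_def)
qed

lemma fixed_vecs_ext:
  "u \<in> fixed_vecs \<Longrightarrow> v \<in> fixed_vecs \<Longrightarrow> (\<And>i. i \<in> {1..n} \<Longrightarrow> u i = v i) \<Longrightarrow> u = v"
  by (rule PiE_ext[of u "{1..n}" "\<lambda>_. UNIV" v]) (simp_all add: fixed_vecs_def vecs_def)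

lemma theta_act_id:
  assumes "v \<in> fixed_vecs"
  shows "theta_act scale n G v = v"
proof (rule fixed_vecs_ext[OF theta_act_fixed assms])
  fix i assume i: "i \<in> {1..n}"
  have "theta_act scale n G v i = (\<Sum>g\<in>G. scale weight (v i))"
    unfolding theta_act_apply[OF i] using assms i by (intro sum.cong) (auto simp: fixed_vecs_def)
  then show "theta_act scale n G v i = v i"
    by (simp add: sum_scale_weight)
qed

text \<open>Averaging lands in the fixed vectors and is the identity on them, so a stable set maps
  onto its fixed part.\<close>

lemma theta_act_image_closed:
  assumes "\<And>v. v \<in> A \<Longrightarrow> theta_act scale n G v \<in> A"
  shows "theta_act scale n G ` A = A \<inter> fixed_vecs"
  using assms theta_act_fixed theta_act_id by force

lemma theta_act_code:
  assumes "G_code scale n G C"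
  shows "theta_act scale n G ` C = C \<inter> fixed_vecs"
proof (rule theta_act_image_closed)
  have "theta G \<in> (group_ring G :: ((nat \<Rightarrow> nat) \<Rightarrow> 'r) set)"
    by (auto simp: theta_def group_ring_def)
  then show "theta_act scale n G v \<in> C" if "v \<in> C" for v
    using assms that by (simp add: G_code_def theta_act_def)
qed

lemma finite_G: "finite G"
proof (rule finite_subset)
  show "G \<subseteq> {p. p permutes {1..n}}" using G_permutes by blast
qed (simp add: finite_permutations)

lemma code_scale_permuted:
  assumes C: "G_code scale n G C" "c \<in> C" and g: "g \<in> G"
  shows "(\<lambda>i\<in>{1..n}. scale a (c (g i))) \<in> C"
proof -
  \<comment> \<open>The coefficient sits at \<open>inv' g\<close> because the action of
    \<open>h\<close> reads position \<open>inv' h i\<close>.\<close>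
  define e where "e = (\<lambda>h\<in>G. if h = inv' g then a else 0)"
  have "group_ring_act scale n G e c \<in> C"
    using C by (auto simp: G_code_def e_def group_ring_def)
  also have "group_ring_act scale n G e c = (\<lambda>i\<in>{1..n}. scale a (c (g i)))"
    unfolding group_ring_act_def
  proof (rule restrict_ext)
    fix i assume i: "i \<in> {1..n}"
    have "(\<Sum>h\<in>G. scale (e h) (perm_act n h c i))
      = (\<Sum>h\<in>G. if h = inv' g then scale a (c (g i)) else 0)"
      using i g by (intro sum.cong) (auto simp: e_def perm_act_def)
    then show "(\<Sum>h\<in>G. scale (e h) (perm_act n h c i)) = scale a (c (g i))"
      using g G_inv finite_G by simp
  qed
  finally show ?thesis .
qed

text \<open>The forms are only additive, so the ring element \<open>1 / |G|\<close> cannot be moved across them. In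
  both inclusions a codeword \<open>c\<close> is instead written as the sum of \<open>|G|\<close> copies of \<open>(1 / |G|) c\<close>.\<close>

lemma theta_act_dual_code:
  assumes \<beta>: "\<beta> \<in> Bil" and C: "G_code scale n G C"
  shows "theta_act scale n G ` dual_code n {\<beta>} C
    = {w \<in> fixed_vecs. \<forall>u\<in>theta_act scale n G ` C. form_power n \<beta> w u = 0}"
proof -
  have dual_closed: "theta_act scale n G v \<in> dual_code n {\<beta>} C" if v: "v \<in> dual_code n {\<beta>} C" for v
  proof -
    have "form_power n \<beta> (theta_act scale n G v) c = 0" if c: "c \<in> C" for c
    proof -
      have "form_power n \<beta> (theta_act scale n G v) c
        = (\<Sum>i=1..n. \<Sum>g\<in>G. \<beta> (v (g i)) (scale weight (c i)))"
        unfolding form_power_def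
      proof (intro sum.cong refl)
        fix i assume i: "i \<in> {1..n}"
        \<comment> \<open>The \<open>|G|\<close> equal terms are collected in the first argument,
          where the factor \<open>|G|\<close> cancels the averaging factor.\<close>
        have "\<beta> (theta_act scale n G v i) (c i)
          = \<beta> (theta_act scale n G v i) (\<Sum>g\<in>G. scale weight (c i))"
          by (simp only: sum_scale_weight)
        also have "\<dots> = \<beta> (\<Sum>g\<in>G. theta_act scale n G v i) (scale weight (c i))"
          by (simp only: Bil_sum[OF \<beta>])
        also have "(\<Sum>g\<in>G. theta_act scale n G v i) = (\<Sum>g\<in>G. v (g i))"
          using scale_weight_sum
          by (simp only: theta_act_apply[OF i] scale_sum[symmetric] sum_const_eq_scale)
        finally show "\<beta> (theta_act scale n G v i) (c i)
          = (\<Sum>g\<in>G. \<beta> (v (g i)) (scale weight (c i)))"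
          by (simp only: Bil_sum[OF \<beta>])
      qed
      also have "\<dots> = (\<Sum>g\<in>G. \<Sum>i=1..n. \<beta> (v (g i)) (scale weight (c i)))"
        by (rule sum.swap)
      also have "\<dots> = (\<Sum>g\<in>G. 0)"
      proof (intro sum.cong refl)
        fix g assume g: "g \<in> G"
        \<comment> \<open>The permutation passes from \<open>v\<close> to the codeword as its
          inverse, and the code absorbs both it and the scalar.\<close>
        have "(\<lambda>i\<in>{1..n}. scale weight (c (inv' g i))) \<in> C"
          using code_scale_permuted[OF C c G_inv[OF g]] .
        then have "form_power n \<beta> v (\<lambda>i\<in>{1..n}. scale weight (c (inv' g i))) = 0"
          using v by (auto simp: dual_code_def)
        then have "(\<Sum>i=1..n. \<beta> (v i) (scale weight (c (inv' g i)))) = 0"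
          by (simp add: form_power_def)
        then show "(\<Sum>i=1..n. \<beta> (v (g i)) (scale weight (c i))) = 0"
          using sum_permuted[OF g, of "\<lambda>i. \<beta> (v i) (scale weight (c (inv' g i)))"] g by simp
      qed
      finally show ?thesis by simp
    qed
    then show ?thesis
      using theta_act_fixed by (auto simp: dual_code_def fixed_vecs_def)
  qed
  \<comment> \<open>Conversely, a fixed \<open>w\<close> does not notice when each of the
    \<open>|G|\<close> copies is permuted by a different group element, and the permuted copies add
    up to the average of the codeword.\<close>
  have "w \<in> dual_code n {\<beta>} C"
    if w: "w \<in> fixed_vecs" and orth: "\<And>u. u \<in> theta_act scale n G ` C \<Longrightarrow> form_power n \<beta> w u = 0" for w
  proof -
    have "form_power n \<beta> w c = 0" if c: "c \<in> C" for c
    proof -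
      have "form_power n \<beta> w c = (\<Sum>i=1..n. \<Sum>g\<in>G. \<beta> (w i) (scale weight (c i)))"
        by (simp only: form_power_def Bil_sum(2)[OF \<beta>, symmetric] sum_scale_weight)
      also have "\<dots> = (\<Sum>g\<in>G. \<Sum>i=1..n. \<beta> (w i) (scale weight (c i)))"
        by (rule sum.swap)
      also have "\<dots> = (\<Sum>g\<in>G. \<Sum>i=1..n. \<beta> (w i) (scale weight (c (g i))))"
      proof (rule sum.cong[OF refl])
        fix g assume g: "g \<in> G"
        have "(\<Sum>i=1..n. \<beta> (w i) (scale weight (c i)))
          = (\<Sum>i=1..n. \<beta> (w (g i)) (scale weight (c (g i))))"
          using sum_permuted[OF g, of "\<lambda>i. \<beta> (w i) (scale weight (c i))"] by simp
        also have "\<dots> = (\<Sum>i=1..n. \<beta> (w i) (scale weight (c (g i))))"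
          using w g by (intro sum.cong) (auto simp: fixed_vecs_def)
        finally show "(\<Sum>i=1..n. \<beta> (w i) (scale weight (c i)))
          = (\<Sum>i=1..n. \<beta> (w i) (scale weight (c (g i))))" .
      qed
      also have "\<dots> = (\<Sum>i=1..n. \<Sum>g\<in>G. \<beta> (w i) (scale weight (c (g i))))"
        by (rule sum.swap)
      also have "\<dots> = form_power n \<beta> w (theta_act scale n G c)"
        unfolding form_power_def by (intro sum.cong) (simp_all add: theta_act_apply Bil_sum[OF \<beta>])
      also have "\<dots> = 0" using orth c by simp
      finally show ?thesis .
    qed
    then show ?thesis using w by (auto simp: dual_code_def fixed_vecs_def)
  qed
  moreover have "form_power n \<beta> w u = 0"
    if "w \<in> dual_code n {\<beta>} C" "u \<in> theta_act scale n G ` C" for w u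
    using that by (auto simp: dual_code_def theta_act_code[OF C])
  ultimately have "dual_code n {\<beta>} C \<inter> fixed_vecs
    = {w \<in> fixed_vecs. \<forall>u\<in>theta_act scale n G ` C. form_power n \<beta> w u = 0}"
    by blast
  then show ?thesis
    using theta_act_image_closed[of "dual_code n {\<beta>} C"] dual_closed by metis
qed

section \<open>Orbits and their lengths\<close>

abbreviation orb :: "nat \<Rightarrow> nat set" where
  "orb \<equiv> orbit (perm_group n G) (\<lambda>g. g)"

lemma orb_eq: "orb i = (\<lambda>g. g i) ` G"
  by (auto simp: orbit_def perm_group_def)

lemma orb_subset: "i \<in> {1..n} \<Longrightarrow> orb i \<subseteq> {1..n}"
  using G_image by (auto simp: orb_eq)

lemma orb_self: "i \<in> orb i"
  unfolding orb_eq by (rule image_eqI[of _ _ id]) (simp_all add: G_id)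

text \<open>From \<open>g i = h j\<close> follows \<open>j = inv' h (g i)\<close>, so the group
  carries \<open>i\<close> to every point of the orbit of \<open>j\<close>; the converse is
  symmetric.\<close>

lemma orb_eq_if_common:
  assumes "k \<in> orb i" "k \<in> orb j"
  shows "orb i = orb j"
proof -
  have sub: "orb j \<subseteq> orb i" if k: "k \<in> orb i" "k \<in> orb j" for i j k
  proof
    fix l assume "l \<in> orb j"
    with k obtain g h e where g: "g \<in> G" "h \<in> G" "e \<in> G" and eq: "k = g i" "k = h j" "l = e j"
      by (auto simp: orb_eq)
    have "j = inv' h (g i)" using eq g by (metis G_inv_cancel(1))
    then have "l = (e \<circ> (inv' h \<circ> g)) i" using eq by simp
    moreover have "e \<circ> (inv' h \<circ> g) \<in> G" using g by (intro G_comp G_inv)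
    ultimately show "l \<in> orb i" unfolding orb_eq by blast
  qed
  show ?thesis using assms sub by blast
qed

text \<open>The library's actions take values in extensional bijections, hence the restriction.\<close>

lemma group_action_restrict: "group_action (perm_group n G) {1..n} (\<lambda>g. restrict g {1..n})"
proof -
  have group: "group (perm_group n G)"
    unfolding perm_group_def by (rule subgroup.subgroup_is_group[OF subgroup_G sym_group_is_group])
  have "restrict g {1..n} \<in> Bij {1..n}" if "g \<in> G" for g
    using permutes_imp_bij[OF G_permutes[OF that]] by (simp add: Bij_def)
  moreover have "restrict (g \<circ> h) {1..n} = compose {1..n} (restrict g {1..n}) (restrict h {1..n})"
    if "g \<in> G" "h \<in> G" for g h
    using G_image[OF that(2)] by (auto simp: compose_def fun_eq_iff)
  ultimately have "(\<lambda>g. restrict g {1..n}) \<in> hom (perm_group n G) (BijGroup {1..n})"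
    by (auto simp: hom_def BijGroup_def perm_group_def sym_group_mult)
  with group show ?thesis
    by (simp add: group_action_def group_hom_def group_hom_axioms_def group_BijGroup)
qed

text \<open>Orbit-stabilizer theorem; restricting the permutations to \<open>{1..n}\<close> does not
  change the orbits of points there.\<close>

lemma card_orb_dvd:
  assumes "i \<in> {1..n}"
  shows "card (orb i) dvd card G"
proof -
  interpret group_action "perm_group n G" "{1..n}" "\<lambda>g. restrict g {1..n}"
    by (rule group_action_restrict)
  have "orbit (perm_group n G) (\<lambda>g. restrict g {1..n}) i = orb i"
    using assms by (simp add: orbit_def)
  moreover have "Coset.order (perm_group n G) = card G"
    by (simp add: Coset.order_def perm_group_def)
  ultimately show ?thesis
    using orbit_stabilizer_theorem[OF assms] by (metis dvd_triv_left)
qed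

text \<open>Multiplying by the cofactor of the orbit length in \<open>card G\<close> turns the
  hypothesis into \<open>|G| w = 0\<close>, and \<open>|G|\<close> acts invertibly.\<close>

lemma sum_const_orb_eq_0:
  fixes w :: 'v
  assumes i: "i \<in> {1..n}" and "(\<Sum>j\<in>orb i. w) = 0"
  shows "w = 0"
proof -
  obtain m where m: "card G = m * card (orb i)"
    using card_orb_dvd[OF i] by (metis dvd_def mult.commute)
  have "(\<Sum>g\<in>G. w) = scale (of_nat m) (\<Sum>j\<in>orb i. w)"
    by (simp add: sum_const_eq_scale m scale_scale)
  also have "\<dots> = 0"
    by (simp only: assms scale_zero_right)
  finally show ?thesis
    using scale_weight_sum[of w] by simp
qed

end

section \<open>Fixed vectors as words indexed by the orbit representatives\<close>

locale averaging_orbits = averaging scale n G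
  for scale :: "'r::ring_1 \<Rightarrow> 'v::{finite, ab_group_add} \<Rightarrow> 'v" and n G +
  fixes t :: nat and \<alpha> :: "nat \<Rightarrow> nat"
  assumes orbit_reps: "orbit_reps n G t \<alpha>"
begin

lemma \<alpha>_in: "k \<in> {1..t} \<Longrightarrow> \<alpha> k \<in> {1..n}"
  using orbit_reps by (auto simp: orbit_reps_def)

lemma orb_\<alpha>_bij: "bij_betw (\<lambda>k. orb (\<alpha> k)) {1..t} (orb ` {1..n})"
proof -
  have "orbits (perm_group n G) {1..n} (\<lambda>g. g) = orb ` {1..n}"
    by (auto simp: orbits_def)
  then show ?thesis using orbit_reps by (simp add: orbit_reps_def)
qed

lemma orb_\<alpha>_disjoint:
  assumes "k \<in> {1..t}" "l \<in> {1..t}" "k \<noteq> l"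
  shows "orb (\<alpha> k) \<inter> orb (\<alpha> l) = {}"
proof (rule ccontr)
  assume "orb (\<alpha> k) \<inter> orb (\<alpha> l) \<noteq> {}"
  then have "orb (\<alpha> k) = orb (\<alpha> l)" using orb_eq_if_common by blast
  with assms show False
    using inj_onD[OF bij_betw_imp_inj_on[OF orb_\<alpha>_bij], of k l] by blast
qed

lemma orb_\<alpha>_cover:
  assumes "i \<in> {1..n}"
  shows "\<exists>k\<in>{1..t}. i \<in> orb (\<alpha> k)"
proof -
  have "orb i \<in> (\<lambda>k. orb (\<alpha> k)) ` {1..t}"
    using bij_betw_imp_surj_on[OF orb_\<alpha>_bij] assms by blast
  then obtain k where "k \<in> {1..t}" "orb i = orb (\<alpha> k)" by blast
  then show ?thesis using orb_self[of i] by blast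
qed

lemma sum_over_orbits: "(\<Sum>i=1..n. f i) = (\<Sum>k=1..t. \<Sum>i\<in>orb (\<alpha> k). f i)"
proof -
  have "{1..n} = (\<Union>k\<in>{1..t}. orb (\<alpha> k))"
    using orb_\<alpha>_cover orb_subset[OF \<alpha>_in] by blast
  then show ?thesis
    using sum.UNION_disjoint[of "{1..t}" "\<lambda>k. orb (\<alpha> k)" f] orb_\<alpha>_disjoint
    by (simp add: orb_eq finite_G)
qed

lemma fixed_vecs_orb:
  assumes "u \<in> fixed_vecs" "i \<in> {1..n}" "j \<in> orb i"
  shows "u j = u i"
  using assms by (auto simp: fixed_vecs_def orb_eq)

text \<open>The coordinate map identifying \<open>fixed_vecs\<close> with V^t.\<close>

definition orbit_values :: "(nat \<Rightarrow> 'v) \<Rightarrow> nat \<Rightarrow> 'v" where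
  "orbit_values u = (\<lambda>k\<in>{1..t}. u (\<alpha> k))"

lemma inj_on_orbit_values: "inj_on orbit_values fixed_vecs"
proof (rule inj_onI)
  fix u v assume u: "u \<in> fixed_vecs" and v: "v \<in> fixed_vecs"
    and eq: "orbit_values u = orbit_values v"
  show "u = v"
  proof (rule fixed_vecs_ext[OF u v])
    fix i assume "i \<in> {1..n}"
    then obtain k where k: "k \<in> {1..t}" "i \<in> orb (\<alpha> k)" using orb_\<alpha>_cover by blast
    have "u (\<alpha> k) = v (\<alpha> k)"
      using fun_cong[OF eq, of k] k by (simp add: orbit_values_def)
    then show "u i = v i"
      using fixed_vecs_orb[OF u \<alpha>_in[OF k(1)] k(2)] fixed_vecs_orb[OF v \<alpha>_in[OF k(1)] k(2)] by simp
  qed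
qed

lemma orbit_values_surj:
  assumes w: "w \<in> {1..t} \<rightarrow>\<^sub>E UNIV"
  shows "\<exists>u\<in>fixed_vecs. orbit_values u = w"
proof -
  \<comment> \<open>\<open>\<kappa> i\<close> is the index of the orbit containing \<open>i\<close>.
    Disjointness makes it unique and hence constant on orbits, so composing \<open>w\<close> with it
    gives a fixed vector.\<close>
  obtain \<kappa> where \<kappa>: "\<And>i. i \<in> {1..n} \<Longrightarrow> \<kappa> i \<in> {1..t} \<and> i \<in> orb (\<alpha> (\<kappa> i))"
    using orb_\<alpha>_cover by metis
  have \<kappa>_eq: "\<kappa> i = k" if "i \<in> {1..n}" "k \<in> {1..t}" "i \<in> orb (\<alpha> k)" for i k
    using \<kappa>[OF that(1)] orb_\<alpha>_disjoint[of k "\<kappa> i"] that by blast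
  define u where "u = (\<lambda>i\<in>{1..n}. w (\<kappa> i))"
  have "u (g i) = u i" if g: "g \<in> G" and i: "i \<in> {1..n}" for g i
  proof -
    have "g i \<in> orb i" using g by (auto simp: orb_eq)
    moreover have "orb (\<alpha> (\<kappa> i)) = orb i"
      using \<kappa>[OF i] orb_self orb_eq_if_common by blast
    ultimately have "\<kappa> (g i) = \<kappa> i"
      using \<kappa>[OF i] G_image[OF g i] by (intro \<kappa>_eq) auto
    then show ?thesis using G_image[OF g i] i by (simp only: u_def restrict_apply')
  qed
  then have "u \<in> fixed_vecs"
    by (auto simp: fixed_vecs_def u_def vecs_def)
  moreover have "orbit_values u = w"
  proof (rule PiE_ext)
    show "orbit_values u \<in> {1..t} \<rightarrow>\<^sub>E UNIV" by (auto simp: orbit_values_def)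
    show "orbit_values u k = w k" if k: "k \<in> {1..t}" for k
      using \<kappa>_eq[OF \<alpha>_in[OF k] k orb_self] \<alpha>_in[OF k] k
      by (simp only: orbit_values_def u_def restrict_apply')
  qed (fact w)
  ultimately show ?thesis by blast
qed

text \<open>On fixed vectors all positions of one orbit contribute the same value, so the inner
  constant sum is \<beta> multiplied by the orbit length.\<close>

lemma form_power_orbit_values:
  assumes "w \<in> fixed_vecs" "u \<in> fixed_vecs"
  shows "form_power n \<beta> w u
    = (\<Sum>k=1..t. \<Sum>i\<in>orb (\<alpha> k). \<beta> (orbit_values w k) (orbit_values u k))"
  unfolding form_power_def sum_over_orbits
proof (intro sum.cong refl)
  fix k i assume k: "k \<in> {1..t}" and i: "i \<in> orb (\<alpha> k)"
  show "\<beta> (w i) (u i) = \<beta> (orbit_values w k) (orbit_values u k)"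
    using k fixed_vecs_orb[OF assms(1) \<alpha>_in[OF k] i] fixed_vecs_orb[OF assms(2) \<alpha>_in[OF k] i]
    by (simp add: orbit_values_def)
qed

text \<open>The exponents count zero and nonzero orbit values, and injectivity on fixed vectors
  ensures that no summands merge in the image.\<close>

lemma hwe_G_eq_weight_enum:
  assumes "A \<subseteq> fixed_vecs"
  shows "hwe_G t \<alpha> A x y = weight_enum {1..t} (orbit_values ` A) x y"
proof -
  have "x ^ (t - wt_G t \<alpha> u) * y ^ wt_G t \<alpha> u
    = (\<Prod>k=1..t. if orbit_values u k = 0 then x else y)" for u
  proof -
    let ?Z = "{k \<in> {1..t}. u (\<alpha> k) \<noteq> 0}"
    have "card ({1..t} - ?Z) = t - card ?Z"
      by (subst card_Diff_subset) auto
    moreover have "{1..t} - ?Z = {1..t} \<inter> {k. u (\<alpha> k) = 0}"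
      and "?Z = {1..t} \<inter> - {k. u (\<alpha> k) = 0}" by auto
    moreover have "(\<Prod>k=1..t. if orbit_values u k = 0 then x else y)
      = (\<Prod>k=1..t. if u (\<alpha> k) = 0 then x else y)"
      by (intro prod.cong) (auto simp: orbit_values_def)
    ultimately show ?thesis
      by (simp add: wt_G_def prod.If_cases)
  qed
  then show ?thesis
    unfolding hwe_G_def weight_enum_def
    by (subst sum.reindex[OF inj_on_subset[OF inj_on_orbit_values assms]]) simp
qed

end

section \<open>Normalization and the G-Hamming weight enumerator\<close>

lemma smult_inverse_of_nat:
  fixes p q :: "complex poly poly"
  assumes "of_nat c * p = q" and "c \<noteq> 0"
  shows "p = smult [:1 / of_nat c:] q"
proof -
  \<comment> \<open>In the iterated ring \<open>of_nat c\<close> is a constant whose coefficient is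
    itself a constant polynomial, hence invertible for nonzero \<open>c\<close>.\<close>
  have "q = smult [:of_nat c:] p"
    using assms(1) by (simp add: of_nat_poly)
  then show ?thesis
    using assms(2) by (simp flip: one_pCons)
qed

theorem theorem1p1:
  fixes scale :: "'r::{finite, ring_1} \<Rightarrow> 'v::{finite, ab_group_add} \<Rightarrow> 'v"
    and n t :: nat
    and G :: "(nat \<Rightarrow> nat) set"
    and \<alpha> :: "nat \<Rightarrow> nat"
    and M :: "('v \<Rightarrow> 'v \<Rightarrow> qmodz) set"
    and C :: "(nat \<Rightarrow> 'v) set"
  assumes "left_module scale"
    and "n > 0"
    and "subgroup G (sym_group n)"
    and "unit_elem (of_nat (card G) :: 'r)"
    and "M \<subseteq> Bil" and "\<forall>\<beta>\<in>M. nondegenerate \<beta>"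
    and "\<exists>\<beta>\<in>M. theta_act scale n G ` dual_code n M C = theta_act scale n G ` dual_code n {\<beta>} C"
    and "G_code scale n G C"
    and "orbit_reps n G t \<alpha>"
  shows "hwe_G t \<alpha> (theta_act scale n G ` C) X_var Y_var =
    smult [:1 / of_nat (card (theta_act scale n G ` dual_code n M C)):]
      (hwe_G t \<alpha> (theta_act scale n G ` dual_code n M C)
        (X_var + (of_nat (card (UNIV :: 'v set)) - 1) * Y_var) (X_var - Y_var))"
proof -
  interpret averaging_orbits scale n G t \<alpha>
    using assms by (simp add: averaging_orbits_def averaging_def averaging_axioms_def
        averaging_orbits_axioms_def)
  \<comment> \<open>The hypothesis on \<open>M\<close> supplies one form with the same averaged
    dual, and the argument continues with that form alone.\<close>
  obtain \<beta> where \<beta>: "\<beta> \<in> Bil" "nondegenerate \<beta>"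
    and dual: "theta_act scale n G ` dual_code n M C = theta_act scale n G ` dual_code n {\<beta>} C"
    using assms by blast
  note C = \<open>G_code scale n G C\<close>
  define D where "D = theta_act scale n G ` C"
  define E where "E = theta_act scale n G ` dual_code n M C"
  have D: "D = C \<inter> fixed_vecs"
    unfolding D_def by (rule theta_act_code[OF C])
  have E: "E = {w \<in> fixed_vecs. \<forall>u\<in>D. form_power n \<beta> w u = 0}"
    unfolding E_def D_def dual by (rule theta_act_dual_code[OF \<beta>(1) C])
  \<comment> \<open>The form of the \<open>k\<close>-th coordinate is \<beta> times the orbit
    length, as a constant sum matching \<open>form_power_orbit_values\<close>.\<close>
  define b where "b = (\<lambda>k v w. \<Sum>i\<in>orb (\<alpha> k). \<beta> v w)"
  have \<beta>_add: "\<beta> (u + v) w = \<beta> u w + \<beta> v w" "\<beta> u (v + w) = \<beta> u v + \<beta> u w" for u v w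
    using \<beta>(1) by (auto simp: Bil_def)
  have b_add: "b k (u + v) w = b k u w + b k v w" "b k u (v + w) = b k u v + b k u w" for k u v w
    by (simp_all only: b_def \<beta>_add sum.distrib)
  have b_nondeg: "w = 0" if k: "k \<in> {1..t}" and w: "\<And>v. b k v w = 0" for k w
  proof -
    \<comment> \<open>Additivity moves the orbit length into the second argument of \<beta>.
      Nondegeneracy, given for the first argument, transfers to the second because both range over
      the same finite group.\<close>
    have "(\<Sum>i\<in>orb (\<alpha> k). w) = 0"
    proof (rule qmodz_char.right_nondegenerate_if_left[of \<beta>, OF \<beta>_add])
      show "v = 0" if "\<And>w. \<beta> v w = 0" for v
        using \<beta>(2) that by (auto simp: nondegenerate_def)
      show "\<beta> v (\<Sum>i\<in>orb (\<alpha> k). w) = 0" for v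
        using w[of v] by (simp only: b_def Bil_sum(2)[OF \<beta>(1)])
    qed simp
    then show ?thesis by (rule sum_const_orb_eq_0[OF \<alpha>_in[OF k]])
  qed
  have zero: "(\<lambda>i\<in>{1..n}. 0) \<in> D"
    using C G_image by (auto simp: D G_code_def fixed_vecs_def vecs_def)
  have add: "(\<lambda>i\<in>{1..n}. u i + v i) \<in> D" if "u \<in> D" "v \<in> D" for u v
    using that C G_image by (auto simp: D G_code_def fixed_vecs_def vecs_def)
  have annihilator: "annihilator {1..t} b (orbit_values ` D) = orbit_values ` E"
    (is "?A = _")
  proof -
    have "orbit_values w \<in> ?A \<longleftrightarrow> w \<in> E" if w: "w \<in> fixed_vecs" for w
    proof -
      have "form_power n \<beta> w u = (\<Sum>k=1..t. b k (orbit_values w k) (orbit_values u k))"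
        if "u \<in> D" for u
        unfolding b_def using that w by (intro form_power_orbit_values) (auto simp: D)
      moreover have "orbit_values w \<in> {1..t} \<rightarrow>\<^sub>E UNIV" by (auto simp: orbit_values_def)
      ultimately show ?thesis
        using w by (auto simp: E annihilator_def)
    qed
    \<comment> \<open>Surjectivity onto all words of length \<open>t\<close> ensures that the
      annihilator holds nothing beyond images of fixed vectors.\<close>
    moreover have "?A \<subseteq> orbit_values ` fixed_vecs"
    proof
      fix w assume "w \<in> ?A"
      then have "w \<in> {1..t} \<rightarrow>\<^sub>E UNIV" unfolding annihilator_def by blast
      from orbit_values_surj[OF this] show "w \<in> orbit_values ` fixed_vecs" by blast
    qed
    moreover have "E \<subseteq> fixed_vecs" unfolding E by blast
    ultimately show ?thesis by blast
  qed
  \<comment> \<open>Since the character takes values in constant polynomials, the formal variables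
    can be inserted directly.\<close>
  have "of_nat (card (orbit_values ` E)) * weight_enum {1..t} (orbit_values ` D) X_var Y_var
    = weight_enum {1..t} (orbit_values ` E)
        (X_var + (of_nat (card (UNIV :: 'v set)) - 1) * Y_var) (X_var - Y_var)"
    unfolding annihilator[symmetric]
  proof (rule qmodz_char.MacWilliams[of "{1..t}" b "orbit_values ` D", OF _ b_add b_nondeg])
    show "orbit_values ` D \<subseteq> {1..t} \<rightarrow>\<^sub>E UNIV" by (auto simp: orbit_values_def)
    show "(\<lambda>k\<in>{1..t}. 0) \<in> orbit_values ` D"
    proof (rule image_eqI[OF _ zero])
      show "(\<lambda>k\<in>{1..t}. 0) = orbit_values (\<lambda>i\<in>{1..n}. 0)"
        unfolding orbit_values_def using \<alpha>_in by (intro restrict_ext) simp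
    qed
    show "(\<lambda>k\<in>{1..t}. u k + v k) \<in> orbit_values ` D"
      if "u \<in> orbit_values ` D" "v \<in> orbit_values ` D" for u v
    proof -
      obtain u' v' where uv: "u' \<in> D" "v' \<in> D" "u = orbit_values u'" "v = orbit_values v'"
        using \<open>u \<in> _\<close> \<open>v \<in> _\<close> by blast
      have "(\<lambda>k\<in>{1..t}. u k + v k) = orbit_values (\<lambda>i\<in>{1..n}. u' i + v' i)"
        unfolding orbit_values_def using \<alpha>_in by (intro restrict_ext) (simp add: uv orbit_values_def)
      then show ?thesis using add[OF uv(1,2)] by simp
    qed
  qed auto
  moreover have "D \<subseteq> fixed_vecs" "E \<subseteq> fixed_vecs" using D E by auto
  moreover from this have "card (orbit_values ` E) = card E"
    by (intro card_image inj_on_subset[OF inj_on_orbit_values])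
  ultimately have "of_nat (card E) * hwe_G t \<alpha> D X_var Y_var
    = hwe_G t \<alpha> E (X_var + (of_nat (card (UNIV :: 'v set)) - 1) * Y_var) (X_var - Y_var)"
    by (simp add: hwe_G_eq_weight_enum)
  \<comment> \<open>Needed for the division: \<open>E\<close> is finite and contains the zero
    vector.\<close>
  moreover have "card E \<noteq> 0"
  proof -
    have "finite (vecs n :: (nat \<Rightarrow> 'v) set)"
      unfolding vecs_def by (intro finite_PiE) auto
    then have "finite E"
      by (rule finite_subset[rotated]) (auto simp: E fixed_vecs_def)
    moreover have "\<beta> 0 v = 0" for v
      using \<beta>_add(1)[of 0 0 v] by simp
    then have "(\<lambda>i\<in>{1..n}. 0) \<in> E"
      using zero by (simp add: E D form_power_def)
    ultimately show ?thesis by auto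
  qed
  ultimately show ?thesis
    unfolding D_def[symmetric] E_def[symmetric] by (metis smult_inverse_of_nat)
qed

end
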